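(* For any three imaginary Fibonacci octonions $F_k,F_m,F_n$ (with $k,m,n\in\mathbb{N}$), one has $$\langle F_k\times F_m,\,F_n\rangle=0.$$
   Context: Let $\mathbb{O}$ be the real division octonion algebra with basis $1,e_1,\dots,e_7$, and let $\mathbb{O}_0$ be the subspace of octonions of trace $0$ (imaginary octonions), i.e. those of the form $\sum_{i=1}^7x_ie_i$ with $x_i\in\mathbb{R}$, identified with $\mathbb{R}^7$. For $n\in\mathbb{N}=\{0,1,2,\dots\}$, the imaginary Fibonacci octonion $F_n\in\mathbb{O}_0$ is $$F_n=f_ne_1+f_{n+1}e_2+f_{n+2}e_3+f_{n+3}e_4+f_{n+4}e_5+f_{n+5}e_6+f_{n+6}e_7,$$ where $(f_j)$ is the Fibonacci sequence $f_0=0$, $f_1=1$, $f_j=f_{j-1}+f_{j-2}$ for $j\ge2$. The inner product of $x=\sum_{i=1}^7x_ie_i$ and $y=\sum_{i=1}^7y_ie_i$ is $\langle x,y\rangle=\sum_{i=1}^7x_iy_i$, and their cross product is $$\begin{aligned}x\times y={}&(x_2y_4-x_4y_2+x_3y_7-x_7y_3+x_5y_6-x_6y_5)\,e_1\\&+(x_3y_5-x_5y_3+x_4y_1-x_1y_4+x_6y_7-x_7y_6)\,e_2\\&+(x_4y_6-x_6y_4+x_5y_2-x_2y_5+x_7y_1-x_1y_7)\,e_3\\&+(x_5y_7-x_7y_5+x_6y_3-x_3y_6+x_1y_2-x_2y_1)\,e_4\\&+(x_6y_1-x_1y_6+x_7y_4-x_4y_7+x_2y_3-x_3y_2)\,e_5\\&+(x_7y_2-x_2y_7+x_1y_5-x_5y_1+x_3y_4-x_4y_3)\,e_6\\&+(x_1y_3-x_3y_1+x_2y_6-x_6y_2+x_4y_5-x_5y_4)\,e_7.\end{aligned}$$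 *)

theory Defs
  imports "HOL-Analysis.Analysis" "HOL-Number_Theory.Fib"
begin

text \<open>
  The imaginary octonions are identified with \<open>\<real>\<^sup>7\<close>, i.e. the type \<open>real ^ 7\<close>. The index type \<open>7\<close> is
  arithmetic modulo 7, so its elements are written \<open>1, \<dots>, 7\<close> here, with \<open>7 = 0\<close>. The inner product
  \<open>\<bullet>\<close> of \<open>real ^ 7\<close> is the standard one.
\<close>

type_synonym imag_octonion = "real ^ 7"

definition oct_e :: "7 \<Rightarrow> imag_octonion" where
  "oct_e i = axis i 1"

definition oct_cross :: "imag_octonion \<Rightarrow> imag_octonion \<Rightarrow> imag_octonion"
    (infixl "\<times>\<^sub>O" 70) where
  "x \<times>\<^sub>O y =
     (x$2 * y$4 - x$4 * y$2 + x$3 * y$7 - x$7 * y$3 + x$5 * y$6 - x$6 * y$5) *\<^sub>R oct_e 1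
   + (x$3 * y$5 - x$5 * y$3 + x$4 * y$1 - x$1 * y$4 + x$6 * y$7 - x$7 * y$6) *\<^sub>R oct_e 2
   + (x$4 * y$6 - x$6 * y$4 + x$5 * y$2 - x$2 * y$5 + x$7 * y$1 - x$1 * y$7) *\<^sub>R oct_e 3
   + (x$5 * y$7 - x$7 * y$5 + x$6 * y$3 - x$3 * y$6 + x$1 * y$2 - x$2 * y$1) *\<^sub>R oct_e 4
   + (x$6 * y$1 - x$1 * y$6 + x$7 * y$4 - x$4 * y$7 + x$2 * y$3 - x$3 * y$2) *\<^sub>R oct_e 5
   + (x$7 * y$2 - x$2 * y$7 + x$1 * y$5 - x$5 * y$1 + x$3 * y$4 - x$4 * y$3) *\<^sub>R oct_e 6
   + (x$1 * y$3 - x$3 * y$1 + x$2 * y$6 - x$6 * y$2 + x$4 * y$5 - x$5 * y$4) *\<^sub>R oct_e 7"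

definition fib_oct :: "nat \<Rightarrow> imag_octonion" where
  "fib_oct n =
     real (fib n) *\<^sub>R oct_e 1 + real (fib (n + 1)) *\<^sub>R oct_e 2 + real (fib (n + 2)) *\<^sub>R oct_e 3
   + real (fib (n + 3)) *\<^sub>R oct_e 4 + real (fib (n + 4)) *\<^sub>R oct_e 5
   + real (fib (n + 5)) *\<^sub>R oct_e 6 + real (fib (n + 6)) *\<^sub>R oct_e 7"

end

theory Submission
  imports Defs
begin

text \<open>
  The Fibonacci recurrence holds for the octonions themselves, \<open>F\<^sub>n\<^sub>+\<^sub>2 = F\<^sub>n + F\<^sub>n\<^sub>+\<^sub>1\<close>, so every \<open>F\<^sub>n\<close> lies
  in the plane spanned by \<open>F\<^sub>0\<close> and \<open>F\<^sub>1\<close> (lemma \<open>fib_oct_in_plane\<close>). The cross product is bilinear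
  and alternating, and \<open>x \<times> y\<close> is orthogonal to \<open>x\<close> and to \<open>y\<close>; hence the triple product
  \<open>\<langle>x \<times> y, z\<rangle>\<close> vanishes on any three vectors of a common plane (lemma \<open>triple_product_plane\<close>).
\<close>

lemma inner_oct_e_left: "oct_e i \<bullet> x = x $ i"
  by (simp add: oct_e_def inner_axis')

lemma oct_cross_add_left: "(x + y) \<times>\<^sub>O z = x \<times>\<^sub>O z + y \<times>\<^sub>O z"
  unfolding oct_cross_def by (simp add: algebra_simps)

lemma oct_cross_scaleR_left: "(a *\<^sub>R x) \<times>\<^sub>O y = a *\<^sub>R (x \<times>\<^sub>O y)"
  unfolding oct_cross_def by (simp add: algebra_simps)

lemma oct_cross_anticommute: "y \<times>\<^sub>O x = - (x \<times>\<^sub>O y)"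
  unfolding oct_cross_def by (simp add: algebra_simps)

lemma oct_cross_add_right: "x \<times>\<^sub>O (y + z) = x \<times>\<^sub>O y + x \<times>\<^sub>O z"
  using oct_cross_anticommute[of x] by (simp add: oct_cross_add_left)

lemma oct_cross_scaleR_right: "x \<times>\<^sub>O (a *\<^sub>R y) = a *\<^sub>R (x \<times>\<^sub>O y)"
  using oct_cross_anticommute[of x] by (simp add: oct_cross_scaleR_left)

lemma oct_cross_self: "x \<times>\<^sub>O x = 0"
  unfolding oct_cross_def by (simp add: mult.commute)

lemma oct_cross_orthogonal_left: "(x \<times>\<^sub>O y) \<bullet> x = 0"
  unfolding oct_cross_def by (simp add: inner_add_left inner_oct_e_left algebra_simps)

lemma oct_cross_orthogonal_right: "(x \<times>\<^sub>O y) \<bullet> y = 0"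
  using oct_cross_orthogonal_left[of y x] oct_cross_anticommute[of y x] by simp

text \<open>
  On the plane of \<open>u\<close> and \<open>v\<close> the cross product takes values in the line of \<open>u \<times> v\<close>, with the
  determinant of the coordinates as factor, and that line is orthogonal to the plane.
\<close>

lemma triple_product_plane:
  fixes u v :: imag_octonion
  shows "((a *\<^sub>R u + b *\<^sub>R v) \<times>\<^sub>O (c *\<^sub>R u + d *\<^sub>R v)) \<bullet> (p *\<^sub>R u + q *\<^sub>R v) = 0"
proof -
  have "(a *\<^sub>R u + b *\<^sub>R v) \<times>\<^sub>O (c *\<^sub>R u + d *\<^sub>R v) = (a * d - b * c) *\<^sub>R (u \<times>\<^sub>O v)"
    by (simp add: oct_cross_add_left oct_cross_add_right oct_cross_scaleR_left
        oct_cross_scaleR_right oct_cross_self oct_cross_anticommute[of v u] algebra_simps)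
  then show ?thesis
    by (simp add: inner_add_right oct_cross_orthogonal_left oct_cross_orthogonal_right)
qed

lemma fib_oct_recurrence: "fib_oct (n + 2) = fib_oct n + fib_oct (n + 1)"
proof -
  have "real (fib (n + 2 + j)) = real (fib (n + j)) + real (fib (n + 1 + j))" for j
    by simp
  from this[of 0] this[of 1] this[of 2] this[of 3] this[of 4] this[of 5] this[of 6]
  show ?thesis
    unfolding fib_oct_def by (simp only: add_0_right scaleR_add_left) (simp add: algebra_simps)
qed

text \<open>
  The coefficient of \<open>F\<^sub>0\<close> is the number \<open>f\<^sub>n\<^sub>-\<^sub>1\<close>, written as a difference so that it has the right
  value \<open>f\<^sub>-\<^sub>1 = 1\<close> at \<open>n = 0\<close>.
\<close>

lemma fib_oct_in_plane:
  "fib_oct n = (real (fib (n + 1)) - real (fib n)) *\<^sub>R fib_oct 0 + real (fib n) *\<^sub>R fib_oct 1"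
proof (induction n rule: fib.induct)
  case (3 n)
  then show ?case
    using fib_oct_recurrence[of n] by (simp add: algebra_simps)
qed simp_all

theorem proposition3p2:
  fixes k m n :: nat
  shows "(fib_oct k \<times>\<^sub>O fib_oct m) \<bullet> fib_oct n = 0"
  unfolding fib_oct_in_plane[of k] fib_oct_in_plane[of m] fib_oct_in_plane[of n]
  by (rule triple_product_plane)

end
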